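(* Let $q$ be a square-free positive integer and $h$ a positive integer. For each prime $p\mid q$ let $\Omega_p\subseteq\mathbb Z/p\mathbb Z$ be a set with $|\Omega_p|=(p-1)/2$ which is not additively structured, with constant $c_p$, i.e. $$\Big|\sum_{x\in\Omega_p}e\Big(\frac{ax}{p}\Big)\Big|<c_p\sqrt p\qquad\text{for all } a\not\equiv 0 \pmod p,$$ where $c_p\ll\log p$. Then $$\frac1q\sum_{n=0}^{q-1}\Bigg(\sum_{\substack{m\in[n,n+h]\\ m\notin\Omega_p\ (\mathrm{mod}\ p)\ \forall p\mid q}}1-h\prod_{p\mid q}\Big(\frac{p+1}{2p}\Big)\Bigg)^{2}\ll h\prod_{p\mid q}\Bigg(\Big(\frac{p+1}{2p}\Big)^2+c_p^2\Bigg),$$ or equivalently $$\mathbf{Var}(\mathcal Y_h)\ll \mathbf{E}(\mathcal Y_h)\prod_{p\mid q}\Big(\frac{p+1}{2p}+\frac{2c_p^2\,p}{p+1}\Big).$$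
   Context: $e(x)=e^{2\pi i x}$. The sum over $m$ runs over integers $m$ in $[n,n+h]$ whose reduction modulo $p$ lies outside $\Omega_p$ for every prime $p\mid q$. $\mathcal Y_h$ is the random variable $\mathcal Y_h(n)=\#\{m\in[n,n+h]: m \bmod p\notin\Omega_p \text{ for all primes } p\mid q\}$, where $n$ is uniformly distributed over residues modulo $q$; that is, it counts elements in $[n,n+h]$ of the set $A\subseteq\{1,\dots,q\}$ (regarded modulo $q$) obtained by removing the residue classes in $\Omega_p$ for all $p\mid q$. $\mathbf E$ and $\mathbf{Var}$ are expectation and variance. $f\ll g$ means $|f|\le Cg$ for a constant $C>0$ independent of $q$, $h$, and the sets $\Omega_p$; the condition $c_p\ll\log p$ means $c_p\le K\log p$ for a fixed constant $K$. *)

theory Defs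
  imports "HOL-Probability.Probability" "HOL-Number_Theory.Cong" "HOL-Computational_Algebra.Squarefree"
begin

definition e :: "real \<Rightarrow> complex" where
  "e x = exp (2 * of_real pi * \<i> * of_real x)"

text \<open>Subsets of \<open>\<int>/p\<int>\<close> are given by their representatives in \<open>{0..<p}\<close>.\<close>

definition not_additively_structured :: "nat \<Rightarrow> int set \<Rightarrow> real \<Rightarrow> bool" where
  "not_additively_structured p \<Omega> c \<longleftrightarrow>
     (\<forall>a::int. \<not> [a = 0] (mod int p) \<longrightarrow>
        norm (\<Sum>x\<in>\<Omega>. e (of_int (a * x) / real p)) < c * sqrt (real p))"

definition sifted :: "nat \<Rightarrow> (nat \<Rightarrow> int set) \<Rightarrow> int set" where
  "sifted q \<Omega> = {m. \<forall>p. prime p \<and> p dvd q \<longrightarrow> m mod int p \<notin> \<Omega> p}"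

definition Y :: "nat \<Rightarrow> (nat \<Rightarrow> int set) \<Rightarrow> nat \<Rightarrow> int \<Rightarrow> real" where
  "Y q \<Omega> h n = real (card {m \<in> {n..n + int h}. m \<in> sifted q \<Omega>})"

text \<open>The uniform distribution on residues modulo \<open>q\<close>; \<open>Y q \<Omega> h\<close> is \<open>q\<close>-periodic,
  so the choice of representatives is immaterial.\<close>

definition unif_residues :: "nat \<Rightarrow> int pmf" where
  "unif_residues q = pmf_of_set {0..<int q}"

end

theory Submission imports Defs begin

text \<open>Expanding the square, the second moment becomes a sum over \<open>i, j \<in> [0, h]\<close> of correlations,
  which factor over the primes by the Chinese remainder theorem. The factor at \<open>p\<close> is
  \<open>((p + 1) / 2p)\<^sup>2 + D\<^sub>p (i - j)\<close>, where \<open>D\<^sub>p\<close> has nonnegative Fourier coefficients, all at most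
  \<open>c\<^sub>p\<^sup>2 / p\<close> and none at frequency \<open>0\<close>. Multiply out over the sets \<open>R\<close> of primes at which \<open>D\<^sub>p\<close> is
  chosen: \<open>R = {}\<close> gives the square of the mean. For the other \<open>R\<close>, with \<open>r\<close> the product of its primes,
  complete the sum of \<open>|\<Sum>\<^sub>i e(a i / r)|\<^sup>2\<close> over nonzero frequencies to all frequencies. Orthogonality
  evaluates the complete sum as \<open>r #{(i, j). r dvd i - j} \<le> (h + 1)\<^sup>2 + (h + 1) r\<close>, and the term
  \<open>(h + 1)\<^sup>2\<close> is exactly the contribution of the frequency \<open>0\<close>, so \<open>R\<close> contributes at most
  \<open>(h + 1) \<Prod>\<^bsub>p \<in> R\<^esub> c\<^sub>p\<^sup>2 \<Prod>\<^bsub>p \<notin> R\<^esub> ((p + 1) / 2p)\<^sup>2\<close>. Summing over \<open>R\<close> reassembles the product.\<close>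

section \<open>Additive characters\<close>

lemma e_add: "e (x + y) = e x * e y"
  by (simp add: e_def exp_add [symmetric] algebra_simps)

lemma cnj_e: "cnj (e x) = e (- x)"
  by (simp add: e_def exp_cnj)

lemma e_zero [simp]: "e 0 = 1"
  by (simp add: e_def)

lemma e_of_nat_mult: "e (of_nat n * x) = e x ^ n"
  by (simp add: e_def exp_of_nat_mult [symmetric] mult_ac)

lemma e_eq_1_iff: "e x = 1 \<longleftrightarrow> x \<in> \<int>"
proof -
  have "e x = 1 \<longleftrightarrow> (\<exists>n::int. 2 * pi * x = of_int (2 * n) * pi)"
    by (simp add: e_def exp_eq_1)
  also have "\<dots> \<longleftrightarrow> (\<exists>n::int. x = of_int n)"
    by (simp add: mult.assoc mult.commute [of pi])
  finally show ?thesis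
    by (auto elim!: Ints_cases)
qed

lemma sum_int_shift_nat: "(\<Sum>a\<in>{0..<int p}. f a) = (\<Sum>k<p. f (int k))"
  by (rule sum.reindex_bij_witness[where i = int and j = nat]) auto

lemma of_int_div_in_Ints_iff:
  assumes "p > 0"
  shows "of_int d / real p \<in> \<int> \<longleftrightarrow> int p dvd d"
proof
  assume "of_int d / real p \<in> \<int>"
  then obtain k where "of_int d / real p = of_int k" by (elim Ints_cases)
  hence "real_of_int d = of_int (k * int p)" using assms by (simp add: field_simps)
  hence "d = k * int p" by (simp only: of_int_eq_iff)
  thus "int p dvd d" by simp
next
  assume "int p dvd d"
  then obtain k where "d = int p * k" ..
  thus "of_int d / real p \<in> \<int>" using assms by simp
qed

text \<open>A geometric sum whose ratio \<open>e (d / p)\<close> is a \<open>p\<close>-th root of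
  unity, equal to 1 exactly when \<open>p\<close> divides \<open>d\<close>.\<close>

lemma sum_e_orthogonality:
  assumes "p > 0"
  shows "(\<Sum>a\<in>{0..<int p}. e (of_int (a * d) / real p)) =
           (if int p dvd d then of_nat p else 0)"
proof -
  let ?z = "e (of_int d / real p)"
  have "(\<Sum>a\<in>{0..<int p}. e (of_int (a * d) / real p)) = (\<Sum>k<p. ?z ^ k)"
    unfolding sum_int_shift_nat by (simp add: e_of_nat_mult [symmetric])
  moreover have "?z ^ p = 1"
    using assms by (simp add: e_of_nat_mult [symmetric] e_eq_1_iff)
  moreover have "?z = 1 \<longleftrightarrow> int p dvd d"
    using assms by (simp add: e_eq_1_iff of_int_div_in_Ints_iff)
  ultimately show ?thesis
    by (simp add: sum_gp_strict)
qed

section \<open>Periodic functions\<close>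

lemma sum_periodic_shift:
  fixes f :: "int \<Rightarrow> 'a::comm_monoid_add"
  assumes "p > 0" and per: "\<And>x. f (x mod int p) = f x"
  shows "(\<Sum>x\<in>{0..<int p}. f (x + i)) = (\<Sum>x\<in>{0..<int p}. f x)"
  by (rule sum.reindex_bij_witness[where i = "\<lambda>x. (x - i) mod int p" and j = "\<lambda>x. (x + i) mod int p"])
     (use assms in \<open>auto simp: per mod_simps\<close>)

text \<open>Only the representative \<open>m mod int p\<close> survives the divisibility condition.
  This collapses the inner sum that orthogonality produces in
  \<open>autocorrelation_fourier\<close>.\<close>

lemma sum_periodic_single:
  fixes g :: "int \<Rightarrow> 'a::comm_semiring_1"
  assumes "p > 0" and per: "\<And>x. g (x mod int p) = g x"
  shows "(\<Sum>v\<in>{0..<int p}. g v * (if int p dvd (m - v) then c else 0)) = g m * c"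
proof -
  have "(\<Sum>v\<in>{0..<int p}. g v * (if int p dvd (m - v) then c else 0)) =
        (\<Sum>v\<in>{m mod int p}. g v * (if int p dvd (m - v) then c else 0))"
    by (rule sum.mono_neutral_right)
       (use assms in \<open>auto simp: mod_eq_dvd_iff [symmetric]\<close>)
  thus ?thesis by (simp add: per mod_eq_dvd_iff [symmetric])
qed

section \<open>Factoring sums by the Chinese remainder theorem\<close>

text \<open>Reduction to the pair of residues is injective by coprimality, and both sides have
  \<open>k * l\<close> elements, so it is a bijection; no explicit inverse is constructed.\<close>

lemma sum_chinese_remainder:
  fixes F G :: "int \<Rightarrow> 'a::comm_semiring_1"
  assumes "k > 0" "l > 0" "coprime k l"
    and F: "\<And>x. F (x mod int k) = F x" and G: "\<And>x. G (x mod int l) = G x"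
  shows "(\<Sum>n\<in>{0..<int (k * l)}. F n * G n) = (\<Sum>x\<in>{0..<int k}. F x) * (\<Sum>y\<in>{0..<int l}. G y)"
proof -
  let ?f = "\<lambda>n::int. (n mod int k, n mod int l)"
  let ?A = "{0..<int (k * l)}" and ?B = "{0..<int k} \<times> {0..<int l}"
  have inj: "inj_on ?f ?A"
  proof (rule inj_onI)
    fix x y assume xy: "x \<in> ?A" "y \<in> ?A" "?f x = ?f y"
    hence "[x = y] (mod (int k * int l))"
      using assms(3) by (intro coprime_cong_mult) (auto simp: cong_def)
    thus "x = y" using xy by (auto simp: cong_def)
  qed
  have "?f ` ?A \<subseteq> ?B" using assms(1,2) by auto
  moreover have "card (?f ` ?A) = card ?B"
    using inj by (simp add: card_image nat_mult_distrib)
  ultimately have "?f ` ?A = ?B"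
    by (intro card_subset_eq) simp_all
  with inj have "bij_betw ?f ?A ?B"
    by (simp add: bij_betw_def)
  hence "(\<Sum>n\<in>?A. (\<lambda>(x, y). F x * G y) (?f n)) = (\<Sum>(x, y)\<in>?B. F x * G y)"
    by (rule sum.reindex_bij_betw)
  thus ?thesis
    by (simp add: F G sum_product sum.cartesian_product)
qed

lemma prod_periodic:
  assumes "finite B" and "\<And>p x. p \<in> B \<Longrightarrow> F p (x mod int p) = F p x"
  shows "(\<Prod>p\<in>B. F p (x mod int (\<Prod>B))) = (\<Prod>p\<in>B. F p x)"
proof (rule prod.cong)
  fix p assume p: "p \<in> B"
  have "F p (x mod int (\<Prod>B)) = F p (x mod int (\<Prod>B) mod int p)"
    using assms(2)[OF p] by simp
  also have "x mod int (\<Prod>B) mod int p = x mod int p"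
    using assms(1) p by (intro mod_mod_cancel) (auto intro: dvd_prodI)
  finally show "F p (x mod int (\<Prod>B)) = F p x"
    using assms(2)[OF p] by simp
qed simp

text \<open>Induction on the set of moduli: a new modulus is coprime to the product of the others,
  and by \<open>prod_periodic\<close> that product is a period of the remaining factors.\<close>

lemma sum_prod_chinese_remainder:
  fixes F :: "nat \<Rightarrow> int \<Rightarrow> 'a::comm_semiring_1"
  assumes "finite B" "\<And>p. p \<in> B \<Longrightarrow> p > 0" "pairwise coprime B"
    and "\<And>p x. p \<in> B \<Longrightarrow> F p (x mod int p) = F p x"
  shows "(\<Sum>n\<in>{0..<int (\<Prod>B)}. \<Prod>p\<in>B. F p n) = (\<Prod>p\<in>B. \<Sum>x\<in>{0..<int p}. F p x)"
  using assms
proof (induction B rule: finite_induct)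
  case (insert p B)
  have "coprime p (\<Prod>B)"
    using insert.prems(2) insert.hyps by (intro prod_coprime_right) (auto simp: pairwise_insert)
  moreover have "\<Prod>B > 0" using insert.prems(1) by (intro prod_pos) auto
  ultimately have "(\<Sum>n\<in>{0..<int (p * \<Prod>B)}. F p n * (\<Prod>p\<in>B. F p n)) =
        (\<Sum>x\<in>{0..<int p}. F p x) * (\<Sum>n\<in>{0..<int (\<Prod>B)}. \<Prod>p\<in>B. F p n)"
    using insert.prems insert.hyps
    by (intro sum_chinese_remainder) (auto simp: prod_periodic simp del: of_nat_prod)
  also have "(\<Sum>n\<in>{0..<int (\<Prod>B)}. \<Prod>p\<in>B. F p n) = (\<Prod>p\<in>B. \<Sum>x\<in>{0..<int p}. F p x)"
    using insert.prems insert.hyps by (intro insert.IH) (auto simp: pairwise_insert)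
  finally show ?case using insert.hyps by simp
qed simp

section \<open>Finite Fourier analysis of autocorrelations\<close>

text \<open>Normalised by \<open>1 / p\<close>, so that the coefficient at 0 is the mean; the sign
  in the exponent agrees with \<open>not_additively_structured\<close>.\<close>

definition fourier_coeff :: "nat \<Rightarrow> (int \<Rightarrow> real) \<Rightarrow> int \<Rightarrow> complex" where
  "fourier_coeff p g a = (\<Sum>x\<in>{0..<int p}. of_real (g x) * e (of_int (a * x) / real p)) / of_nat p"

text \<open>The Wiener-Khinchin identity on Z/pZ. Expanding the squared modulus into a double sum
  over \<open>u\<close> and \<open>v\<close>, orthogonality in \<open>a\<close> keeps only
  \<open>v\<close> congruent to \<open>u + (i - j)\<close>. All coefficients on the right are
  nonnegative, which is what the large sieve exploits.\<close>

lemma autocorrelation_fourier: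
  assumes p: "p > 0" and per: "\<And>x. g (x mod int p) = g x"
  shows "of_real ((\<Sum>x\<in>{0..<int p}. g (x + i) * g (x + j)) / real p) =
    (\<Sum>a\<in>{0..<int p}. of_real ((cmod (fourier_coeff p g a))\<^sup>2) * e (of_int (a * (i - j)) / real p))"
proof -
  let ?I = "{0..<int p}"
  let ?G = "\<lambda>x. complex_of_real (g x)"
  have sq: "of_real ((cmod (fourier_coeff p g a))\<^sup>2) * e (of_int (a * (i - j)) / real p) =
    (\<Sum>u\<in>?I. \<Sum>v\<in>?I. ?G u * ?G v * e (of_int (a * ((u + (i - j)) - v)) / real p)) / (of_nat p)\<^sup>2" for a
  proof -
    have "of_real ((cmod (fourier_coeff p g a))\<^sup>2) = fourier_coeff p g a * cnj (fourier_coeff p g a)"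
      by (rule complex_norm_square)
    also have "\<dots> = (\<Sum>u\<in>?I. \<Sum>v\<in>?I. (?G u * e (of_int (a * u) / real p)) *
        (?G v * e (- (of_int (a * v) / real p)))) / (of_nat p)\<^sup>2"
      by (simp add: fourier_coeff_def cnj_e sum_product power2_eq_square)
    finally show ?thesis
      by (simp add: sum_distrib_right sum_distrib_left e_add [symmetric] mult_ac ring_distribs
          add_divide_distrib diff_divide_distrib)
         (simp add: e_add diff_conv_add_uminus mult_ac del: add_uminus_conv_diff)
  qed
  have "(\<Sum>a\<in>?I. of_real ((cmod (fourier_coeff p g a))\<^sup>2) * e (of_int (a * (i - j)) / real p)) =
     (\<Sum>u\<in>?I. \<Sum>v\<in>?I. \<Sum>a\<in>?I. ?G u * ?G v * e (of_int (a * ((u + (i - j)) - v)) / real p)) / (of_nat p)\<^sup>2"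
    unfolding sq sum_divide_distrib [symmetric]
    by (subst sum.swap, subst (2) sum.swap) (rule refl)
  also have "\<dots> = (\<Sum>u\<in>?I. ?G u * (\<Sum>v\<in>?I. ?G v *
      (if int p dvd ((u + (i - j)) - v) then of_nat p else 0))) / (of_nat p)\<^sup>2"
    by (simp only: sum_distrib_left [symmetric] sum_e_orthogonality[OF p] mult.assoc)
  also have "\<dots> = (\<Sum>u\<in>?I. ?G u * (?G (u + (i - j)) * of_nat p)) / (of_nat p)\<^sup>2"
    using sum_periodic_single[OF p, of ?G] per by simp
  also have "\<dots> = of_real ((\<Sum>u\<in>?I. g u * g (u + (i - j))) / real p)"
    using p by (simp add: power2_eq_square field_simps sum_distrib_left sum_divide_distrib)
  \<comment> \<open>Translating by \<open>j\<close> restores the symmetric form, since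
    \<open>x + j + (i - j) = x + i\<close>.\<close>
  also have "(\<Sum>u\<in>?I. g u * g (u + (i - j))) = (\<Sum>x\<in>?I. g (x + j) * g (x + j + (i - j)))"
  proof (rule sum_periodic_shift[OF p, symmetric])
    fix x
    show "g (x mod int p) * g (x mod int p + (i - j)) = g x * g (x + (i - j))"
      using per[of "x mod int p + (i - j)"] per[of "x + (i - j)"] per[of x] by (simp add: mod_simps)
  qed
  finally show ?thesis by (simp add: mult.commute algebra_simps)
qed

section \<open>The large sieve bound and the variance\<close>

text \<open>Members of one residue class modulo \<open>r\<close> are told apart by their quotients
  by \<open>r\<close>, which take at most \<open>h div r + 1\<close> values on the interval.\<close>

lemma card_cong_interval_le:
  assumes "r > 0"
  shows "r * card {j\<in>{0..int h}. int r dvd (i - j)} \<le> h + r"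
proof -
  let ?A = "{j\<in>{0..int h}. int r dvd (i - j)}"
  have "inj_on (\<lambda>j. j div int r) ?A"
  proof (rule inj_onI)
    fix x y assume "x \<in> ?A" "y \<in> ?A" "x div int r = y div int r"
    moreover from this have "x mod int r = y mod int r"
      by (simp add: mod_eq_dvd_iff [symmetric])
    ultimately show "x = y"
      by (metis div_mult_mod_eq)
  qed
  moreover have "(\<lambda>j. j div int r) ` ?A \<subseteq> {0..int h div int r}"
    using assms by (auto intro!: zdiv_mono1 simp: pos_imp_zdiv_nonneg_iff)
  ultimately have "card ?A \<le> card {0..int h div int r}"
    by (intro card_inj_on_le) auto
  also have "\<dots> = h div r + 1"
    by (simp add: zdiv_int [symmetric] nat_add_distrib)
  finally have "r * card ?A \<le> r * (h div r + 1)"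
    by (rule mult_le_mono2)
  also have "\<dots> \<le> h + r" by (simp add: times_div_less_eq_dividend)
  finally show ?thesis .
qed

lemma prod_dvd_iff:
  fixes d :: int
  assumes "finite R" "pairwise coprime R"
  shows "int (\<Prod>R) dvd d \<longleftrightarrow> (\<forall>p\<in>R. int p dvd d)"
proof
  assume "int (\<Prod>R) dvd d"
  moreover have "int p dvd int (\<Prod>R)" if "p \<in> R" for p
    using dvd_prodI[OF assms(1) that, of "\<lambda>p. p"] by (simp only: of_nat_dvd_iff)
  ultimately show "\<forall>p\<in>R. int p dvd d" by (blast intro: dvd_trans)
next
  assume "\<forall>p\<in>R. int p dvd d"
  hence "[d = 0] (mod (\<Prod>p\<in>R. int p))"
    using assms(2) by (intro cong_cong_prod_coprime) (auto simp: cong_0_iff pairwise_def)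
  thus "int (\<Prod>R) dvd d" by (simp add: cong_0_iff)
qed

text \<open>A frequency \<open>a / r\<close>, with \<open>r\<close> the product of \<open>R\<close>,
  is encoded by its components: modulo 1 it is the sum of the fractions
  \<open>\<alpha> p / p\<close>. In this form it matches a product of local Fourier
  expansions.\<close>

definition exp_sum :: "nat \<Rightarrow> nat set \<Rightarrow> (nat \<Rightarrow> int) \<Rightarrow> complex" where
  "exp_sum h R \<alpha> = (\<Sum>i\<in>{0..int h}. \<Prod>p\<in>R. e (of_int (\<alpha> p * i) / real p))"

lemma norm_exp_sum_square:
  "of_real ((cmod (exp_sum h R \<alpha>))\<^sup>2) =
     (\<Sum>i\<in>{0..int h}. \<Sum>j\<in>{0..int h}. \<Prod>p\<in>R. e (of_int (\<alpha> p * (i - j)) / real p))"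
  by (simp only: complex_norm_square)
     (simp add: exp_sum_def cnj_e sum_product prod.distrib [symmetric] e_add [symmetric]
        ring_distribs diff_divide_distrib)

lemma large_sieve_complete:
  assumes R: "finite R" "\<And>p. p \<in> R \<Longrightarrow> p > 0" "pairwise coprime R"
  shows "(\<Sum>\<alpha>\<in>PiE R (\<lambda>p. {0..<int p}). (cmod (exp_sum h R \<alpha>))\<^sup>2)
           \<le> (real h + 1)\<^sup>2 + (real h + 1) * real (\<Prod>R)"
proof -
  let ?P = "PiE R (\<lambda>p. {0..<int p})" and ?r = "\<Prod>R" and ?H = "{0..int h}"
  have "of_real (\<Sum>\<alpha>\<in>?P. (cmod (exp_sum h R \<alpha>))\<^sup>2) =
      (\<Sum>i\<in>?H. \<Sum>j\<in>?H. \<Sum>\<alpha>\<in>?P. \<Prod>p\<in>R. e (of_int (\<alpha> p * (i - j)) / real p))"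
    unfolding of_real_sum norm_exp_sum_square
    by (subst sum.swap, subst (2) sum.swap) (rule refl)
  also have "\<dots> = (\<Sum>i\<in>?H. \<Sum>j\<in>?H. of_nat (if int ?r dvd (i - j) then ?r else 0))"
  proof (intro sum.cong refl)
    fix i j
    have "(\<Sum>\<alpha>\<in>?P. \<Prod>p\<in>R. e (of_int (\<alpha> p * (i - j)) / real p)) =
        (\<Prod>p\<in>R. \<Sum>a\<in>{0..<int p}. e (of_int (a * (i - j)) / real p))"
      by (rule prod_sum_PiE [symmetric]) (use R in auto)
    also have "\<dots> = (\<Prod>p\<in>R. if int p dvd (i - j) then of_nat p else 0)"
      by (intro prod.cong refl sum_e_orthogonality R)
    also have "\<dots> = of_nat (if int ?r dvd (i - j) then ?r else 0)"
    proof (cases "int ?r dvd (i - j)")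
      case True
      thus ?thesis using R by (simp add: prod_dvd_iff del: of_nat_prod) simp
    next
      case False
      thus ?thesis using R by (auto simp: prod_dvd_iff simp del: of_nat_prod)
    qed
    finally show "(\<Sum>\<alpha>\<in>?P. \<Prod>p\<in>R. e (of_int (\<alpha> p * (i - j)) / real p)) =
      of_nat (if int ?r dvd (i - j) then ?r else 0)" .
  qed
  also have "\<dots> = of_real (real (\<Sum>i\<in>?H. \<Sum>j\<in>?H. if int ?r dvd (i - j) then ?r else 0))"
    by (simp only: of_nat_sum of_real_sum of_real_of_nat_eq)
  finally have "(\<Sum>\<alpha>\<in>?P. (cmod (exp_sum h R \<alpha>))\<^sup>2) =
      real (\<Sum>i\<in>?H. \<Sum>j\<in>?H. if int ?r dvd (i - j) then ?r else 0)"
    by (simp only: of_real_eq_iff)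
  also have "(\<Sum>i\<in>?H. \<Sum>j\<in>?H. if int ?r dvd (i - j) then ?r else 0) =
      (\<Sum>i\<in>?H. ?r * card {j\<in>?H. int ?r dvd (i - j)})"
    by (simp add: sum.inter_filter [symmetric] mult.commute del: of_nat_prod)
  also have "\<dots> \<le> (\<Sum>i\<in>?H. h + ?r)"
    using R by (intro sum_mono card_cong_interval_le prod_pos) auto
  also have "\<dots> = (h + 1) * (h + ?r)"
    by (simp add: nat_add_distrib)
  \<comment> \<open>The bound is relaxed by \<open>h + 1\<close> so that its first term equals the
    contribution of the zero frequency, which is subtracted in
    \<open>large_sieve_nonzero\<close>.\<close>
  also have "real \<dots> \<le> (real h + 1)\<^sup>2 + (real h + 1) * real ?r"
    by (simp add: power2_eq_square algebra_simps del: of_nat_prod)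
  finally show ?thesis by simp
qed

text \<open>The zero frequency alone accounts for \<open>(h + 1)^2\<close> in the complete sum, and
  all other terms are nonnegative. For nonempty \<open>R\<close> it is not among the tuples with all
  components nonzero.\<close>

lemma large_sieve_nonzero:
  assumes R: "finite R" "\<And>p. p \<in> R \<Longrightarrow> p > 0" "pairwise coprime R" "R \<noteq> {}"
  shows "(\<Sum>\<alpha>\<in>PiE R (\<lambda>p. {1..<int p}). (cmod (exp_sum h R \<alpha>))\<^sup>2) \<le> (real h + 1) * real (\<Prod>R)"
proof -
  let ?P = "PiE R (\<lambda>p. {0..<int p})" and ?Q = "PiE R (\<lambda>p. {1..<int p})"
  \<comment> \<open>Elements of \<open>PiE\<close> are \<open>undefined\<close> outside
    \<open>R\<close>, so the zero frequency has to be a restricted function.\<close>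
  let ?z = "restrict (\<lambda>_. 0) R :: nat \<Rightarrow> int"
  let ?S = "\<lambda>\<alpha>. (cmod (exp_sum h R \<alpha>))\<^sup>2"
  have "?z \<notin> ?Q" using R(4) by (auto simp: PiE_iff)
  moreover have "finite ?P" "finite ?Q" using R by (auto intro: finite_PiE)
  moreover have "insert ?z ?Q \<subseteq> ?P" using R(2) by (auto simp: PiE_iff) fastforce+
  ultimately have "?S ?z + sum ?S ?Q \<le> sum ?S ?P"
    using sum_mono2[of ?P "insert ?z ?Q" ?S] by simp
  moreover have "exp_sum h R ?z = of_nat (h + 1)"
    by (simp add: exp_sum_def nat_add_distrib)
  hence "?S ?z = (real h + 1)\<^sup>2"
    by (simp only: norm_of_nat) simp
  ultimately show ?thesis
    using large_sieve_complete[OF R(1-3), of h] by linarith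
qed

text \<open>Multiplying out the expansions of \<open>D p\<close> gives a combination of the squares
  of \<open>exp_sum\<close> with nonnegative weights, so each weight may be replaced by its upper
  bound. The denominators \<open>p\<close> then cancel the factor \<open>\<Prod>R\<close> of the
  large sieve.\<close>

lemma weighted_large_sieve:
  fixes w D :: "nat \<Rightarrow> int \<Rightarrow> real" and b :: "nat \<Rightarrow> real"
  assumes R: "finite R" "\<And>p. p \<in> R \<Longrightarrow> p > 0" "pairwise coprime R" "R \<noteq> {}"
    and w: "\<And>p a. p \<in> R \<Longrightarrow> a \<in> {1..<int p} \<Longrightarrow> 0 \<le> w p a \<and> w p a \<le> b p / real p"
    and b: "\<And>p. p \<in> R \<Longrightarrow> b p \<ge> 0"
    and D: "\<And>p d. p \<in> R \<Longrightarrow>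
      of_real (D p d) = (\<Sum>a\<in>{1..<int p}. of_real (w p a) * e (of_int (a * d) / real p))"
  shows "(\<Sum>i\<in>{0..int h}. \<Sum>j\<in>{0..int h}. \<Prod>p\<in>R. D p (i - j)) \<le> (real h + 1) * (\<Prod>p\<in>R. b p)"
proof -
  let ?Q = "PiE R (\<lambda>p. {1..<int p})" and ?H = "{0..int h}"
  have "of_real (\<Sum>i\<in>?H. \<Sum>j\<in>?H. \<Prod>p\<in>R. D p (i - j)) =
    (\<Sum>i\<in>?H. \<Sum>j\<in>?H. \<Sum>\<alpha>\<in>?Q. \<Prod>p\<in>R. of_real (w p (\<alpha> p)) * e (of_int (\<alpha> p * (i - j)) / real p))"
    unfolding of_real_sum of_real_prod
    by (intro sum.cong refl) (use R in \<open>simp add: D prod_sum_PiE\<close>)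
  also have "\<dots> = (\<Sum>\<alpha>\<in>?Q. \<Sum>i\<in>?H. \<Sum>j\<in>?H. of_real (\<Prod>p\<in>R. w p (\<alpha> p)) *
      (\<Prod>p\<in>R. e (of_int (\<alpha> p * (i - j)) / real p)))"
    by (subst (2) sum.swap, subst sum.swap) (simp add: prod.distrib)
  also have "\<dots> = of_real (\<Sum>\<alpha>\<in>?Q. (\<Prod>p\<in>R. w p (\<alpha> p)) * (cmod (exp_sum h R \<alpha>))\<^sup>2)"
    by (simp only: of_real_sum of_real_mult norm_exp_sum_square sum_distrib_left)
  finally have "(\<Sum>i\<in>?H. \<Sum>j\<in>?H. \<Prod>p\<in>R. D p (i - j)) =
      (\<Sum>\<alpha>\<in>?Q. (\<Prod>p\<in>R. w p (\<alpha> p)) * (cmod (exp_sum h R \<alpha>))\<^sup>2)"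
    by (simp only: of_real_eq_iff)
  also have "\<dots> \<le> (\<Sum>\<alpha>\<in>?Q. (\<Prod>p\<in>R. b p / real p) * (cmod (exp_sum h R \<alpha>))\<^sup>2)"
    by (intro sum_mono mult_right_mono prod_mono w) (auto simp: PiE_iff)
  also have "\<dots> = (\<Prod>p\<in>R. b p / real p) * (\<Sum>\<alpha>\<in>?Q. (cmod (exp_sum h R \<alpha>))\<^sup>2)"
    by (rule sum_distrib_left [symmetric])
  also have "\<dots> \<le> (\<Prod>p\<in>R. b p / real p) * ((real h + 1) * real (\<Prod>R))"
    by (intro mult_left_mono large_sieve_nonzero R prod_nonneg) (use b in auto)
  also have "\<dots> = (real h + 1) * (\<Prod>p\<in>R. b p / real p * real p)"
    by (simp only: prod.distrib of_nat_prod mult_ac)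
  also have "(\<Prod>p\<in>R. b p / real p * real p) = (\<Prod>p\<in>R. b p)"
    using R(2) by (intro prod.cong) force+
  finally show ?thesis .
qed

section \<open>Moments of window sums of products of periodic functions\<close>

text \<open>For each offset \<open>i\<close> the average factors over the moduli, and translation
  invariance removes \<open>i\<close>. The window has \<open>h + 1\<close> points, so the mean is
  exact with this factor.\<close>

lemma mean_over_windows:
  fixes g :: "nat \<Rightarrow> int \<Rightarrow> real"
  assumes B: "finite B" "\<And>p. p \<in> B \<Longrightarrow> p > 0" "pairwise coprime B"
    and per: "\<And>p x. p \<in> B \<Longrightarrow> g p (x mod int p) = g p x"
  shows "(\<Sum>n\<in>{0..<int (\<Prod>B)}. \<Sum>i\<in>{0..int h}. \<Prod>p\<in>B. g p (n + i)) / real (\<Prod>B) =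
           (real h + 1) * (\<Prod>p\<in>B. (\<Sum>x\<in>{0..<int p}. g p x) / real p)"
proof -
  have per': "g p (x mod int p + i) = g p (x + i)" if "p \<in> B" for p x i
    using per[OF that, of "x mod int p + i"] per[OF that, of "x + i"] by (simp add: mod_simps)
  have "(\<Sum>n\<in>{0..<int (\<Prod>B)}. \<Prod>p\<in>B. g p (n + i)) = (\<Prod>p\<in>B. \<Sum>x\<in>{0..<int p}. g p x)" for i
  proof -
    have "(\<Sum>n\<in>{0..<int (\<Prod>B)}. \<Prod>p\<in>B. g p (n + i)) = (\<Prod>p\<in>B. \<Sum>x\<in>{0..<int p}. g p (x + i))"
      by (rule sum_prod_chinese_remainder[OF B]) (simp_all add: per')
    also have "\<dots> = (\<Prod>p\<in>B. \<Sum>x\<in>{0..<int p}. g p x)"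
      by (intro prod.cong refl sum_periodic_shift B per)
    finally show ?thesis .
  qed
  thus ?thesis
    by (subst sum.swap) (simp add: prod_dividef nat_add_distrib)
qed

lemma variance_over_windows:
  fixes g :: "nat \<Rightarrow> int \<Rightarrow> real" and b \<mu> :: "nat \<Rightarrow> real"
  assumes B: "finite B" "\<And>p. p \<in> B \<Longrightarrow> p > 0" "pairwise coprime B"
    and per: "\<And>p x. p \<in> B \<Longrightarrow> g p (x mod int p) = g p x"
    and \<mu>: "\<And>p. p \<in> B \<Longrightarrow> \<mu> p = (\<Sum>x\<in>{0..<int p}. g p x) / real p"
    and fc: "\<And>p a. p \<in> B \<Longrightarrow> a \<in> {1..<int p} \<Longrightarrow> (cmod (fourier_coeff p (g p) a))\<^sup>2 \<le> b p / real p"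
    and b: "\<And>p. p \<in> B \<Longrightarrow> b p \<ge> 0"
  shows "(\<Sum>n\<in>{0..<int (\<Prod>B)}. ((\<Sum>i\<in>{0..int h}. \<Prod>p\<in>B. g p (n + i)) - (real h + 1) * (\<Prod>p\<in>B. \<mu> p))\<^sup>2) / real (\<Prod>B)
           \<le> (real h + 1) * (\<Prod>p\<in>B. (\<mu> p)\<^sup>2 + b p)"
proof -
  let ?N = "{0..<int (\<Prod>B)}" and ?H = "{0..int h}"
  define F where "F n = (\<Sum>i\<in>?H. \<Prod>p\<in>B. g p (n + i))" for n
  define m where "m = (real h + 1) * (\<Prod>p\<in>B. \<mu> p)"
  define w where "w p a = (cmod (fourier_coeff p (g p) a))\<^sup>2" for p a
  \<comment> \<open>The deviation of the local correlation at lag \<open>d\<close> from the square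
    of the local mean.\<close>
  define D where "D p d = (\<Sum>x\<in>{0..<int p}. g p (x + d) * g p x) / real p - (\<mu> p)\<^sup>2" for p d
  have Bpos: "real (\<Prod>B) > 0" using B(2) by (simp add: prod_pos)
  have per': "g p (x mod int p + i) = g p (x + i)" if "p \<in> B" for p x i
    using per[OF that, of "x mod int p + i"] per[OF that, of "x + i"] by (simp add: mod_simps)
  \<comment> \<open>The weight at frequency 0 is the square of the mean, so subtracting that square
    leaves only nonzero frequencies.\<close>
  have fourier: "of_real ((\<Sum>x\<in>{0..<int p}. g p (x + i) * g p (x + j)) / real p - (\<mu> p)\<^sup>2) =
     (\<Sum>a\<in>{1..<int p}. of_real (w p a) * e (of_int (a * (i - j)) / real p))" if p: "p \<in> B" for p i j
  proof -
    have "fourier_coeff p (g p) 0 = of_real (\<mu> p)"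
      by (simp add: fourier_coeff_def \<mu>[OF p])
    hence "w p 0 = (\<mu> p)\<^sup>2" by (simp add: w_def)
    moreover have "{0..<int p} = insert 0 {1..<int p}" using B(2)[OF p] by auto
    moreover have "complex_of_real ((\<Sum>x\<in>{0..<int p}. g p (x + i) * g p (x + j)) / real p) =
        (\<Sum>a\<in>{0..<int p}. of_real (w p a) * e (of_int (a * (i - j)) / real p))"
      unfolding w_def by (rule autocorrelation_fourier) (use B(2) per p in auto)
    ultimately show ?thesis
      by (simp add: of_real_diff)
  qed
  \<comment> \<open>The shifts \<open>i, j\<close> and \<open>i - j, 0\<close> have the same Fourier
    expansion, so the correlation depends only on the lag.\<close>
  have corr: "(\<Sum>x\<in>{0..<int p}. g p (x + i) * g p (x + j)) / real p = D p (i - j) + (\<mu> p)\<^sup>2"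
    if p: "p \<in> B" for p i j
  proof -
    have "complex_of_real ((\<Sum>x\<in>{0..<int p}. g p (x + i) * g p (x + j)) / real p - (\<mu> p)\<^sup>2) =
          of_real (D p (i - j))"
      unfolding D_def fourier[OF p] using fourier[OF p, of "i - j" 0] by simp
    hence "(\<Sum>x\<in>{0..<int p}. g p (x + i) * g p (x + j)) / real p - (\<mu> p)\<^sup>2 = D p (i - j)"
      by (rule of_real_eq_iff [THEN iffD1])
    thus ?thesis by linarith
  qed
  have "(\<Sum>n\<in>?N. (F n)\<^sup>2) / real (\<Prod>B) =
     (\<Sum>i\<in>?H. \<Sum>j\<in>?H. (\<Sum>n\<in>?N. \<Prod>p\<in>B. g p (n + i) * g p (n + j)) / real (\<Prod>B))"
    unfolding F_def power2_eq_square sum_product prod.distrib [symmetric] sum_divide_distrib [symmetric]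
    by (subst sum.swap, subst (2) sum.swap) (rule refl)
  also have "\<dots> = (\<Sum>i\<in>?H. \<Sum>j\<in>?H. \<Prod>p\<in>B. D p (i - j) + (\<mu> p)\<^sup>2)"
  proof (intro sum.cong refl)
    fix i j
    have "(\<Sum>n\<in>?N. \<Prod>p\<in>B. g p (n + i) * g p (n + j)) =
       (\<Prod>p\<in>B. \<Sum>x\<in>{0..<int p}. g p (x + i) * g p (x + j))"
      by (rule sum_prod_chinese_remainder[OF B]) (simp_all add: per')
    thus "(\<Sum>n\<in>?N. \<Prod>p\<in>B. g p (n + i) * g p (n + j)) / real (\<Prod>B) = (\<Prod>p\<in>B. D p (i - j) + (\<mu> p)\<^sup>2)"
      by (simp add: prod_dividef [symmetric] corr [symmetric])
  qed
  also have "\<dots> = (\<Sum>R\<in>Pow B. (\<Sum>i\<in>?H. \<Sum>j\<in>?H. \<Prod>p\<in>R. D p (i - j)) * (\<Prod>p\<in>B - R. (\<mu> p)\<^sup>2))"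
    unfolding prod_add[OF B(1)] sum_distrib_right
    by (subst (2) sum.swap, subst sum.swap) (rule refl)
  \<comment> \<open>For \<open>R = {}\<close> the product of the \<open>D p\<close> is 1, leaving
    the square of the mean; this cancels exactly when passing from the second moment to the
    variance.\<close>
  also have "\<dots> = m\<^sup>2 + (\<Sum>R\<in>Pow B - {{}}. (\<Sum>i\<in>?H. \<Sum>j\<in>?H. \<Prod>p\<in>R. D p (i - j)) * (\<Prod>p\<in>B - R. (\<mu> p)\<^sup>2))"
    using B(1) by (subst sum.remove[of _ "{}"])
      (simp_all add: m_def power2_eq_square prod.distrib nat_add_distrib algebra_simps)
  also have "\<dots> \<le> m\<^sup>2 + (\<Sum>R\<in>Pow B - {{}}. ((real h + 1) * (\<Prod>p\<in>R. b p)) * (\<Prod>p\<in>B - R. (\<mu> p)\<^sup>2))"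
  proof (intro add_left_mono sum_mono mult_right_mono)
    fix R assume "R \<in> Pow B - {{}}"
    hence R: "R \<subseteq> B" "R \<noteq> {}" by auto
    show "(\<Sum>i\<in>?H. \<Sum>j\<in>?H. \<Prod>p\<in>R. D p (i - j)) \<le> (real h + 1) * (\<Prod>p\<in>R. b p)"
    proof (rule weighted_large_sieve[where w = w])
      show "finite R" using R B(1) by (auto intro: finite_subset)
      show "pairwise coprime R" using R B(3) by (auto intro: pairwise_subset)
      show "of_real (D p d) = (\<Sum>a\<in>{1..<int p}. of_real (w p a) * e (of_int (a * d) / real p))"
        if "p \<in> R" for p d
        using fourier[of p d 0] that R by (auto simp: D_def)
    qed (use R B b fc in \<open>auto simp: w_def\<close>)
  qed (auto intro: prod_nonneg)
  \<comment> \<open>Putting back the nonnegative term for \<open>R = {}\<close> lets the sum over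
    all subsets fold into a product.\<close>
  also have "\<dots> \<le> m\<^sup>2 + (\<Sum>R\<in>Pow B. ((real h + 1) * (\<Prod>p\<in>R. b p)) * (\<Prod>p\<in>B - R. (\<mu> p)\<^sup>2))"
    using B b by (intro add_left_mono sum_mono2) (auto intro!: mult_nonneg_nonneg prod_nonneg)
  also have "\<dots> = m\<^sup>2 + (real h + 1) * (\<Prod>p\<in>B. (\<mu> p)\<^sup>2 + b p)"
    by (simp add: prod_add[OF B(1)] sum_distrib_left mult.assoc add.commute[of "(\<mu> _)\<^sup>2"])
  finally have second: "(\<Sum>n\<in>?N. (F n)\<^sup>2) / real (\<Prod>B) \<le> m\<^sup>2 + (real h + 1) * (\<Prod>p\<in>B. (\<mu> p)\<^sup>2 + b p)" .
  have "(\<Sum>n\<in>?N. F n) / real (\<Prod>B) = m"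
    using mean_over_windows[where g = g and h = h, OF B per] by (simp add: F_def m_def \<mu>)
  hence first: "(\<Sum>n\<in>?N. F n) = m * real (\<Prod>B)"
    using Bpos by (simp add: field_simps)
  have "(\<Sum>n\<in>?N. (F n - m)\<^sup>2) = (\<Sum>n\<in>?N. (F n)\<^sup>2) - 2 * m * (\<Sum>n\<in>?N. F n) + real (\<Prod>B) * m\<^sup>2"
    by (simp add: power2_diff sum.distrib sum_subtractf sum_distrib_left mult_ac del: of_nat_prod)
  also have "\<dots> / real (\<Prod>B) = (\<Sum>n\<in>?N. (F n)\<^sup>2) / real (\<Prod>B) - m\<^sup>2"
    unfolding first using Bpos by (simp add: field_simps power2_eq_square)
  finally show ?thesis
    using second by (simp add: F_def m_def)
qed

section \<open>Local densities and Fourier coefficients of the sifted set\<close>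

lemma prod_prime_divisors_squarefree:
  fixes q :: nat
  assumes "q > 0" "squarefree q"
  shows "\<Prod>{p. prime p \<and> p dvd q} = q"
proof -
  have "q = (\<Prod>p\<in>prime_factors q. p ^ multiplicity p q)"
    using assms(1) by (rule prime_factorization_nat)
  also have "\<dots> = \<Prod>(prime_factors q)"
    using assms by (intro prod.cong) (auto simp: squarefree_factorial_semiring')
  also have "prime_factors q = {p. prime p \<and> p dvd q}"
    using assms(1) by (auto simp: prime_factors_dvd)
  finally show ?thesis by simp
qed

lemma sum_indicator_complement:
  assumes "\<Omega> \<subseteq> {0..<int p}"
  shows "(\<Sum>x\<in>{0..<int p}. of_bool (x mod int p \<notin> \<Omega>) * f x) =
           (\<Sum>x\<in>{0..<int p}. f x) - (\<Sum>x\<in>\<Omega>. f x :: 'a::comm_ring_1)"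
proof -
  have "(\<Sum>x\<in>{0..<int p}. of_bool (x mod int p \<notin> \<Omega>) * f x) = (\<Sum>x\<in>{0..<int p} - \<Omega>. f x)"
    by (rule sum.mono_neutral_cong_right) auto
  thus ?thesis using assms by (simp add: sum_diff)
qed

lemma mean_indicator_complement:
  assumes "p > 0" "\<Omega> \<subseteq> {0..<int p}" "real (card \<Omega>) = (real p - 1) / 2"
  shows "(\<Sum>x\<in>{0..<int p}. of_bool (x mod int p \<notin> \<Omega>)) / real p = (real p + 1) / (2 * real p)"
  using sum_indicator_complement[OF assms(2), of "\<lambda>_. 1::real"] assms by (simp add: field_simps)

text \<open>The full character sum vanishes at a nonzero frequency, so the complement has the
  opposite coefficient to \<open>\<Omega>\<close>. Dividing the squared bound \<open>c^2 * p\<close>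
  by \<open>p^2\<close> gives \<open>c^2 / p\<close>.\<close>

lemma fourier_coeff_indicator_complement:
  assumes "p > 0" "\<Omega> \<subseteq> {0..<int p}" "not_additively_structured p \<Omega> c" "a \<in> {1..<int p}"
  shows "(cmod (fourier_coeff p (\<lambda>x. of_bool (x mod int p \<notin> \<Omega>)) a))\<^sup>2 \<le> c\<^sup>2 / real p"
proof -
  have a: "\<not> int p dvd a" using assms(4) by (auto dest: zdvd_imp_le)
  let ?S = "\<Sum>x\<in>\<Omega>. e (of_int (a * x) / real p)"
  have "(\<Sum>x\<in>{0..<int p}. e (of_int (a * x) / real p)) = 0"
    using sum_e_orthogonality[OF assms(1), of a] a by (simp add: mult.commute)
  moreover have "complex_of_real (of_bool P) = of_bool P" for P by (cases P) simp_all
  ultimately have "fourier_coeff p (\<lambda>x. of_bool (x mod int p \<notin> \<Omega>)) a = - ?S / of_nat p"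
    using sum_indicator_complement[OF assms(2), of "\<lambda>x. e (of_int (a * x) / real p)"]
    by (simp only: fourier_coeff_def diff_0)
  hence "(cmod (fourier_coeff p (\<lambda>x. of_bool (x mod int p \<notin> \<Omega>)) a))\<^sup>2 = (cmod ?S)\<^sup>2 / (real p)\<^sup>2"
    by (simp add: norm_divide power_divide)
  also have "cmod ?S < c * sqrt (real p)"
    using assms(3) a by (simp add: not_additively_structured_def cong_0_iff)
  hence "(cmod ?S)\<^sup>2 / (real p)\<^sup>2 \<le> (c * sqrt (real p))\<^sup>2 / (real p)\<^sup>2"
    by (intro divide_right_mono power_mono) auto
  also have "\<dots> = c\<^sup>2 / real p"
    using assms(1) by (simp add: power_mult_distrib) (simp add: power2_eq_square)
  finally show ?thesis .
qed

text \<open>Survival of the sieve is a product of local indicators; moving the interval to start at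
  0 puts the count into the form of the window sums.\<close>

lemma Y_eq_sum_prod:
  assumes "q > 0"
  shows "Y q \<Omega> h n = (\<Sum>i\<in>{0..int h}. \<Prod>p | prime p \<and> p dvd q. of_bool ((n + i) mod int p \<notin> \<Omega> p))"
proof -
  let ?B = "{p. prime p \<and> p dvd q}"
  have "finite ?B" using assms by (auto intro: finite_subset[OF _ finite_divisors_nat[of q]])
  hence sifted: "(\<Prod>p\<in>?B. of_bool (m mod int p \<notin> \<Omega> p)) = (of_bool (m \<in> sifted q \<Omega>) :: real)" for m
    by (auto simp: sifted_def)
  have "Y q \<Omega> h n = (\<Sum>m\<in>{n..n + int h}. of_bool (m \<in> sifted q \<Omega>))"
    by (simp add: Y_def of_bool_def sum.If_cases Int_def)
  also have "\<dots> = (\<Sum>i\<in>{0..int h}. of_bool (n + i \<in> sifted q \<Omega>))"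
    by (rule sum.reindex_bij_witness[where i = "\<lambda>i. n + i" and j = "\<lambda>m. m - n"]) auto
  finally show ?thesis by (simp only: sifted)
qed

theorem theorem1p2:
  fixes K :: real
  shows "\<exists>C>0. \<forall>(q::nat) (h::nat) (\<Omega> :: nat \<Rightarrow> int set) (c :: nat \<Rightarrow> real).
    q > 0 \<longrightarrow> squarefree q \<longrightarrow> h > 0 \<longrightarrow>
    (\<forall>p. prime p \<and> p dvd q \<longrightarrow>
        \<Omega> p \<subseteq> {0..<int p} \<and>
        real (card (\<Omega> p)) = (real p - 1) / 2 \<and>
        not_additively_structured p (\<Omega> p) (c p) \<and>
        c p \<le> K * ln (real p)) \<longrightarrow>
    (1 / real q) * (\<Sum>n\<in>{0..int q - 1}.
        ((\<Sum>m | m \<in> {n..n + int h} \<and> m \<in> sifted q \<Omega>. 1)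
          - real h * (\<Prod>p | prime p \<and> p dvd q. (real p + 1) / (2 * real p)))\<^sup>2)
      \<le> C * (real h * (\<Prod>p | prime p \<and> p dvd q. ((real p + 1) / (2 * real p))\<^sup>2 + (c p)\<^sup>2))
    \<and>
    measure_pmf.variance (unif_residues q) (Y q \<Omega> h)
      \<le> C * (measure_pmf.expectation (unif_residues q) (Y q \<Omega> h)
          * (\<Prod>p | prime p \<and> p dvd q.
               (real p + 1) / (2 * real p) + 2 * (c p)\<^sup>2 * real p / (real p + 1)))"
\<comment> \<open>The constant comes from the first bound, where
  \<open>(h + 2) * Q \<le> 3 * h * Q\<close> for \<open>h \<ge> 1\<close>. The second bound is
  obtained with constant 1 and then weakened.\<close>
proof (intro exI[of _ "3::real"] conjI allI impI)
  fix q h :: nat and \<Omega> :: "nat \<Rightarrow> int set" and c :: "nat \<Rightarrow> real"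
  assume q: "q > 0" "squarefree q" and h: "h > 0"
  assume *: "\<forall>p. prime p \<and> p dvd q \<longrightarrow>
        \<Omega> p \<subseteq> {0..<int p} \<and>
        real (card (\<Omega> p)) = (real p - 1) / 2 \<and>
        not_additively_structured p (\<Omega> p) (c p) \<and>
        c p \<le> K * ln (real p)"
  define B where "B = {p. prime p \<and> p dvd q}"
  define \<mu> where "\<mu> p = (real p + 1) / (2 * real p)" for p :: nat
  define g :: "nat \<Rightarrow> int \<Rightarrow> real" where "g p x = of_bool (x mod int p \<notin> \<Omega> p)" for p x
  define M where "M = (\<Prod>p\<in>B. \<mu> p)"
  define Q where "Q = (\<Prod>p\<in>B. (\<mu> p)\<^sup>2 + (c p)\<^sup>2)"
  let ?N = "{0..<int q}" and ?Y = "Y q \<Omega> h"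
  have B: "finite B" "\<And>p. p \<in> B \<Longrightarrow> p > 0" "pairwise coprime B" "\<Prod>B = q"
    using q by (auto simp: B_def pairwise_def prime_gt_0_nat primes_coprime prod_prime_divisors_squarefree
        intro: finite_subset[OF _ finite_divisors_nat[of q]])
  have per: "g p (x mod int p) = g p x" for p x
    by (simp add: g_def)
  have mean: "\<mu> p = (\<Sum>x\<in>{0..<int p}. g p x) / real p" if "p \<in> B" for p
    using mean_indicator_complement[OF B(2)[OF that], of "\<Omega> p"] * that
    by (simp add: B_def g_def \<mu>_def)
  have Y: "?Y n = (\<Sum>i\<in>{0..int h}. \<Prod>p\<in>B. g p (n + i))" for n
    unfolding g_def B_def by (rule Y_eq_sum_prod[OF q(1)])
  have expectation: "(\<Sum>n\<in>?N. ?Y n) / real q = (real h + 1) * M"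
    using mean_over_windows[where g = g and h = h, OF B(1-3) per] unfolding Y B(4) M_def
    by (simp add: mean)
  have variance: "(\<Sum>n\<in>?N. (?Y n - (real h + 1) * M)\<^sup>2) / real q \<le> (real h + 1) * Q"
  proof -
    have "(cmod (fourier_coeff p (g p) a))\<^sup>2 \<le> (c p)\<^sup>2 / real p" if "p \<in> B" "a \<in> {1..<int p}" for p a
      unfolding g_def using * B(2)[of p] that
      by (intro fourier_coeff_indicator_complement) (auto simp: B_def)
    thus ?thesis
      using variance_over_windows[where g = g and \<mu> = \<mu> and b = "\<lambda>p. (c p)\<^sup>2" and h = h, OF B(1-3) per mean]
      unfolding Y M_def Q_def B(4) by simp
  qed
  have Q: "Q \<ge> 0" "M\<^sup>2 \<le> Q"
    unfolding Q_def M_def prod_power_distrib by (auto intro!: prod_nonneg prod_mono)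

  show "(1 / real q) * (\<Sum>n\<in>{0..int q - 1}.
        ((\<Sum>m | m \<in> {n..n + int h} \<and> m \<in> sifted q \<Omega>. 1)
          - real h * (\<Prod>p | prime p \<and> p dvd q. (real p + 1) / (2 * real p)))\<^sup>2)
      \<le> 3 * (real h * (\<Prod>p | prime p \<and> p dvd q. ((real p + 1) / (2 * real p))\<^sup>2 + (c p)\<^sup>2))"
  proof -
    have "{0..int q - 1} = ?N" by auto
    hence "(1 / real q) * (\<Sum>n\<in>{0..int q - 1}.
        ((\<Sum>m | m \<in> {n..n + int h} \<and> m \<in> sifted q \<Omega>. 1)
          - real h * (\<Prod>p | prime p \<and> p dvd q. (real p + 1) / (2 * real p)))\<^sup>2) =
        (\<Sum>n\<in>?N. (?Y n - real h * M)\<^sup>2) / real q"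
      by (simp add: Y_def M_def \<mu>_def B_def)
    \<comment> \<open>The interval holds \<open>h + 1\<close> integers, so the true mean is
      \<open>(h + 1) * M\<close>. Recentring there from \<open>h * M\<close> costs exactly
      \<open>M^2\<close> on average, which \<open>Q\<close> absorbs.\<close>
    also have "(\<Sum>n\<in>?N. (?Y n - real h * M)\<^sup>2) =
        (\<Sum>n\<in>?N. (?Y n - (real h + 1) * M)\<^sup>2 + 2 * M * ?Y n - (2 * real h + 1) * M\<^sup>2)"
      by (intro sum.cong refl) (simp add: power2_eq_square algebra_simps)
    also have "\<dots> / real q = (\<Sum>n\<in>?N. (?Y n - (real h + 1) * M)\<^sup>2) / real q
        + 2 * M * ((\<Sum>n\<in>?N. ?Y n) / real q) - (2 * real h + 1) * M\<^sup>2"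
      using q(1) by (simp add: sum.distrib sum_subtractf sum_distrib_left [symmetric] field_simps)
    also have "\<dots> = (\<Sum>n\<in>?N. (?Y n - (real h + 1) * M)\<^sup>2) / real q + M\<^sup>2"
      unfolding expectation by (simp add: power2_eq_square algebra_simps)
    also have "\<dots> \<le> (real h + 1) * Q + Q"
      using variance Q by linarith
    also have "\<dots> \<le> 3 * (real h * Q)"
      using mult_right_mono[OF _ Q(1), of 1 "real h"] h by (simp add: algebra_simps)
    finally show ?thesis
      by (simp add: Q_def \<mu>_def B_def)
  qed

  show "measure_pmf.variance (unif_residues q) ?Y
      \<le> 3 * (measure_pmf.expectation (unif_residues q) ?Y
          * (\<Prod>p | prime p \<and> p dvd q.
               (real p + 1) / (2 * real p) + 2 * (c p)\<^sup>2 * real p / (real p + 1)))"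
  proof -
    let ?T = "\<Prod>p\<in>B. \<mu> p + 2 * (c p)\<^sup>2 * real p / (real p + 1)"
    have E: "measure_pmf.expectation (unif_residues q) f = (\<Sum>n\<in>?N. f n) / real q" for f :: "int \<Rightarrow> real"
      using q(1) unfolding unif_residues_def by (subst integral_pmf_of_set) auto
    have "M * ?T = (\<Prod>p\<in>B. \<mu> p * (\<mu> p + 2 * (c p)\<^sup>2 * real p / (real p + 1)))"
      by (simp add: M_def prod.distrib)
    also have "\<dots> = Q"
      unfolding Q_def
    proof (rule prod.cong)
      fix p assume "p \<in> B"
      \<comment> \<open>The local density and \<open>2 * p / (p + 1)\<close> are reciprocal, so
        pulling one factor \<open>\<mu> p\<close> out of each factor of \<open>Q\<close> turns the
        first form of the bound into the second.\<close>
      hence "\<mu> p * (2 * real p / (real p + 1)) = 1"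
        using B(2)[of p] by (simp add: \<mu>_def)
      hence "\<mu> p * (2 * (c p)\<^sup>2 * real p / (real p + 1)) = (c p)\<^sup>2"
        by (metis (no_types, opaque_lifting) mult.assoc mult.commute mult_1 times_divide_eq_right)
      thus "\<mu> p * (\<mu> p + 2 * (c p)\<^sup>2 * real p / (real p + 1)) = (\<mu> p)\<^sup>2 + (c p)\<^sup>2"
        by (simp only: ring_distribs power2_eq_square)
    qed simp
    finally have MT: "M * ?T = Q" .
    have "measure_pmf.variance (unif_residues q) ?Y \<le> (real h + 1) * Q"
      unfolding E expectation by (rule variance)
    also have "\<dots> \<le> 3 * ((real h + 1) * Q)"
      using Q(1) by simp
    also have "(real h + 1) * Q = measure_pmf.expectation (unif_residues q) ?Y * ?T"
      unfolding E expectation MT [symmetric] by (rule mult.assoc [symmetric])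
    finally show ?thesis
      by (simp add: \<mu>_def B_def)
  qed
qed simp

end
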